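(* Let $\mathcal A$ be a positive definite, self-adjoint linear operator with compact inverse and dense domain $D(\mathcal A)$ in a Hilbert space $\mathcal H$ with norm $\|\cdot\|$, with eigenvalues $0<\lambda_1\le\lambda_2\le\cdots$, $\lambda_j\to\infty$. Let $T>0$, $u^0\in\mathcal H$ and $f:[0,T]\to\mathcal H$. Let the fine scheme $(r,\{p_i\}_{i=1}^m,\{c_i\}_{i=1}^m)$ and the coarse scheme $(R,\{P_i\}_{i=1}^M,\{C_i\}_{i=1}^M)$ both satisfy conditions (P1)--(P3) of the context, with accuracy orders at least $1$, and suppose that for $q$ equal to each of these two orders, $f^{(\ell)}\in C([0,T];D(\mathcal A^{q-\ell}))$ for $0\le \ell\le q-1$ and $f^{(q)}\in L^1(0,T;\mathcal H)$. Let $J\ge 1$ be an integer, $\Delta T=J\Delta t$, $N_c=T/\Delta T\in\mathbb N$. Let $u^n$ be the solution of the fine scheme with step $\Delta t$ and initial value $u^0$, and let $U^n_k$ be the solution of the parareal algorithm at coarse time $T_n=n\Delta T$ after $k$ iterations. Then there is a constant $c$, independent of $k$, $\Delta T$, $\Delta t$ and $J$, such that for all $k\ge 0$ $$\max_{1\le n\le N_c}\|U^n_k-u^{nJ}\|\le c\,\kappa_c(r,R;J)^k,$$ where $$\kappa_c(r,R;J)=\sup_{s\in\Lambda}\left|\frac{r(s/J)^J-R(s)}{1-|R(s)|}\right|,\qquad \Lambda=\{\Delta T\lambda_j\}_{j=1}^\infty .$$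
   Context: The evolution problem is $u'(t)+\mathcal A u(t)=f(t)$ for $0<t<T$, $u(0)=u^0$. A single step scheme is given by rational functions $r,p_1,\dots,p_m$ and distinct real numbers $c_1,\dots,c_m\in[0,1]$. Conditions on it: - (P1) $|r(\lambda)|<1$ for all $\lambda>0$; there is a constant $c$ with $|p_i(\lambda)|<c$ for all $\lambda>0$ and all $i$; and the numerator of each $p_i$ has strictly lower degree than its denominator. - (P2) The scheme is accurate of order $q$: $r(\lambda)=e^{-\lambda}+\mathcal O(\lambda^{q+1})$ as $\lambda\to0$, and for every $0\le j\le q$, $\sum_{i=1}^m c_i^j p_i(\lambda)-\frac{j!}{(-\lambda)^{j+1}}\big(e^{-\lambda}-\sum_{\ell=0}^j\frac{(-\lambda)^\ell}{\ell!}\big)=\mathcal O(\lambda^{q-j})$ as $\lambda\to0$. - (P3) $|r(\infty)|<1$, where $r(\infty)=\lim_{\lambda\to\infty}r(\lambda)$. The same conditions, for the coarse scheme, are read with $(R,P_i,C_i)$ in place of $(r,p_i,c_i)$ (and $M$ in place of $m$). Propagators: with $t_n=n\Delta t$ and $T_n=n\Delta T$, $\mathcal F(t,\Delta t,v,f)=r(\Delta t\mathcal A)v+\Delta t\sum_{i=1}^m p_i(\Delta t\mathcal A)f(t+c_i\Delta t)$ and $\mathcal G(t,\Delta T,v,f)=R(\Delta T\mathcal A)v+\Delta T\sum_{i=1}^M P_i(\Delta T\mathcal A)f(t+C_i\Delta T)$, where functions of $\mathcal A$ are defined by the spectral calculus. Fine solution: $u^{n+1}=\mathcal F(t_n,\Delta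 t,u^n,f)$ starting from the given $u^0$. Parareal algorithm: $U^0_0=u^0$, $U^{n+1}_0=\mathcal G(T_n,\Delta T,U^n_0,f)$ for $0\le n\le N_c-1$. For $k=0,1,\dots$: for each $n$ set $\widetilde U^{n,0}_k=U^n_k$, $\widetilde U^{n,j+1}_k=\mathcal F(T_n+j\Delta t,\Delta t,\widetilde U^{n,j}_k,f)$ for $0\le j\le J-1$, and $\widetilde U^{n+1}_k=\widetilde U^{n,J}_k$; then $U^0_{k+1}=u^0$ and $U^{n+1}_{k+1}=\mathcal G(T_n,\Delta T,U^n_{k+1},f)+\widetilde U^{n+1}_k-\mathcal G(T_n,\Delta T,U^n_k,f)$ for $0\le n\le N_c-1$. Convention: $0^0=1$. *)

theory Defs
  imports
    "HOL-Analysis.Analysis"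
    "HOL-Library.Landau_Symbols"
    "HOL-Computational_Algebra.Polynomial_Factorial"
    "HOL-Computational_Algebra.Field_as_Ring"
begin

section \<open>Unbounded operators on a Hilbert space\<close>

text \<open>
  An operator is a pair of a domain \<open>D\<close> and a map \<open>A\<close>; only the values of \<open>A\<close> on \<open>D\<close> matter.
\<close>

definition densely_defined_linear :: "'h::real_inner set \<Rightarrow> ('h \<Rightarrow> 'h) \<Rightarrow> bool" where
  "densely_defined_linear D A \<longleftrightarrow>
     subspace D \<and> closure D = UNIV \<and>
     (\<forall>x\<in>D. \<forall>y\<in>D. A (x + y) = A x + A y) \<and>
     (\<forall>a. \<forall>x\<in>D. A (a *\<^sub>R x) = a *\<^sub>R A x)"

text \<open>
  The left-hand side of the equivalence says that \<open>(y, z)\<close> lies in the graph of the adjoint, so this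
  is equality of \<open>A\<close> with its adjoint, domains included, and not just symmetry.
\<close>

definition self_adjoint :: "'h::real_inner set \<Rightarrow> ('h \<Rightarrow> 'h) \<Rightarrow> bool" where
  "self_adjoint D A \<longleftrightarrow>
     (\<forall>y z. (\<forall>x\<in>D. inner (A x) y = inner x z) \<longleftrightarrow> y \<in> D \<and> A y = z)"

definition positive_definite :: "'h::real_inner set \<Rightarrow> ('h \<Rightarrow> 'h) \<Rightarrow> bool" where
  "positive_definite D A \<longleftrightarrow> (\<forall>x\<in>D. x \<noteq> 0 \<longrightarrow> inner (A x) x > 0)"

definition compact_inverse :: "'h::real_inner set \<Rightarrow> ('h \<Rightarrow> 'h) \<Rightarrow> bool" where
  "compact_inverse D A \<longleftrightarrow>
     bij_betw A D UNIV \<and> (\<forall>B. bounded B \<longrightarrow> compact (closure (inv_into D A ` B)))"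

definition eigenspace :: "'h::real_inner set \<Rightarrow> ('h \<Rightarrow> 'h) \<Rightarrow> real \<Rightarrow> 'h set" where
  "eigenspace D A \<mu> = {x \<in> D. A x = \<mu> *\<^sub>R x}"

definition eigenvalues :: "'h::real_inner set \<Rightarrow> ('h \<Rightarrow> 'h) \<Rightarrow> real set" where
  "eigenvalues D A = {\<mu>. \<exists>x\<in>eigenspace D A \<mu>. x \<noteq> 0}"

text \<open>
  All eigenvalues in nondecreasing order, repeated according to multiplicity; \<open>lam j\<close> is
  \<open>\<lambda>\<^bsub>j+1\<^esub>\<close>.
\<close>

definition eigenvalue_sequence :: "'h::real_inner set \<Rightarrow> ('h \<Rightarrow> 'h) \<Rightarrow> (nat \<Rightarrow> real) \<Rightarrow> bool" where
  "eigenvalue_sequence D A lam \<longleftrightarrow>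
     0 < lam 0 \<and> incseq lam \<and> filterlim lam at_top sequentially \<and>
     range lam = eigenvalues D A \<and>
     (\<forall>\<mu>. card {j. lam j = \<mu>} = dim (eigenspace D A \<mu>))"

definition orth_proj :: "'h::real_inner set \<Rightarrow> 'h \<Rightarrow> 'h" where
  "orth_proj S v = (THE p. p \<in> S \<and> (\<forall>y\<in>S. inner (v - p) y = 0))"

text \<open>
  \<open>g(A) v\<close> is the sum over the distinct eigenvalues \<open>\<mu>\<close> of \<open>g(\<mu>) E(\<mu>) v\<close>, where \<open>E(\<mu>)\<close> projects
  orthogonally onto the eigenspace of \<open>\<mu>\<close>: the spectral measure of an operator with compact inverse
  is purely atomic. The terms are mutually orthogonal, so the sum converges unconditionally for
  every \<open>v\<close> when \<open>g\<close> is bounded on the spectrum, the only case that is used.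
\<close>

definition spectral_fun ::
  "'h::real_inner set \<Rightarrow> ('h \<Rightarrow> 'h) \<Rightarrow> (real \<Rightarrow> real) \<Rightarrow> 'h \<Rightarrow> 'h" where
  "spectral_fun D A g v = (\<Sum>\<^sub>\<infinity>\<mu>\<in>eigenvalues D A. g \<mu> *\<^sub>R orth_proj (eigenspace D A \<mu>) v)"

definition pow_domain :: "'h::real_inner set \<Rightarrow> ('h \<Rightarrow> 'h) \<Rightarrow> nat \<Rightarrow> 'h set" where
  "pow_domain D A k = {x. \<forall>i<k. (A ^^ i) x \<in> D}"

section \<open>Regularity of the source term\<close>

definition continuous_into_pow_domain ::
  "'h::real_inner set \<Rightarrow> ('h \<Rightarrow> 'h) \<Rightarrow> nat \<Rightarrow> real \<Rightarrow> (real \<Rightarrow> 'h) \<Rightarrow> bool" where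
  "continuous_into_pow_domain D A k T g \<longleftrightarrow>
     (\<forall>t\<in>{0..T}. g t \<in> pow_domain D A k) \<and>
     (\<forall>i\<le>k. continuous_on {0..T} (\<lambda>t. (A ^^ i) (g t)))"

text \<open>
  \<open>df l\<close> is the \<open>l\<close>-th derivative of \<open>f\<close>. The last one is only integrable, and is the derivative of
  \<open>df (q - 1)\<close> in the weak sense, that is, \<open>df (q - 1)\<close> is a Bochner primitive of it. The Bochner
  integral of the library needs \<open>second_countable_topology\<close>; this is no restriction here, since a
  Hilbert space with a densely defined operator that has a compact inverse is separable.
\<close>

definition source_regular ::
  "'h::{real_inner, banach, second_countable_topology} set \<Rightarrow> ('h \<Rightarrow> 'h) \<Rightarrow> real \<Rightarrow> nat
    \<Rightarrow> (real \<Rightarrow> 'h) \<Rightarrow> bool" where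
  "source_regular D A T q f \<longleftrightarrow>
     (\<exists>df :: nat \<Rightarrow> real \<Rightarrow> 'h.
        (\<forall>t\<in>{0..T}. df 0 t = f t) \<and>
        (\<forall>l. Suc l < q \<longrightarrow>
           (\<forall>t\<in>{0..T}. (df l has_vector_derivative df (Suc l) t) (at t within {0..T}))) \<and>
        (\<forall>l<q. continuous_into_pow_domain D A (q - l) T (df l)) \<and>
        set_integrable lebesgue {0..T} (df q) \<and>
        (\<forall>l. Suc l = q \<longrightarrow>
           (\<forall>t\<in>{0..T}. df l t = df l 0 + (LINT s:{0..t}|lebesgue. df q s))))"

section \<open>Single step schemes\<close>

text \<open>
  A rational function is an element of the fraction field of the real polynomials. It is evaluated
  through its representation in lowest terms, so the zeros of \<open>rat_den r\<close> are exactly the poles of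
  \<open>r\<close>. At a pole \<open>rat_eval\<close> takes the junk value 0, so the bounds in \<open>stable_scheme\<close>
  exclude poles explicitly.
\<close>

type_synonym ratfun = "real poly fract"

definition rat_num :: "ratfun \<Rightarrow> real poly" where
  "rat_num r = fst (quot_of_fract r)"

definition rat_den :: "ratfun \<Rightarrow> real poly" where
  "rat_den r = snd (quot_of_fract r)"

definition rat_eval :: "ratfun \<Rightarrow> real \<Rightarrow> real" where
  "rat_eval r x = poly (rat_num r) x / poly (rat_den r) x"

text \<open>
  The stages are numbered \<open>1, ..., stages S\<close>; \<open>weight S\<close> and \<open>node S\<close> are irrelevant elsewhere.
\<close>

record scheme =
  stability :: ratfun
  stages :: nat
  weight :: "nat \<Rightarrow> ratfun"
  node :: "nat \<Rightarrow> real"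

definition valid_nodes :: "scheme \<Rightarrow> bool" where
  "valid_nodes S \<longleftrightarrow> inj_on (node S) {1..stages S} \<and> node S ` {1..stages S} \<subseteq> {0..1}"

text \<open>
  The zero function, whose numerator has degree \<open>-\<infinity>\<close> by convention but \<open>degree 0 = 0\<close> in the
  library, needs separate treatment in the degree condition.
\<close>

definition stable_scheme :: "scheme \<Rightarrow> bool" where
  "stable_scheme S \<longleftrightarrow>
     (\<forall>x>0. poly (rat_den (stability S)) x \<noteq> 0 \<and> \<bar>rat_eval (stability S) x\<bar> < 1) \<and>
     (\<exists>c. \<forall>x>0. \<forall>i\<in>{1..stages S}.
        poly (rat_den (weight S i)) x \<noteq> 0 \<and> \<bar>rat_eval (weight S i) x\<bar> < c) \<and>
     (\<forall>i\<in>{1..stages S}.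
        rat_num (weight S i) = 0 \<or> degree (rat_num (weight S i)) < degree (rat_den (weight S i)))"

definition accurate_of_order :: "scheme \<Rightarrow> nat \<Rightarrow> bool" where
  "accurate_of_order S q \<longleftrightarrow>
     (\<lambda>x. rat_eval (stability S) x - exp (- x)) \<in> O[at 0](\<lambda>x. x ^ (q + 1)) \<and>
     (\<forall>j\<le>q.
        (\<lambda>x. (\<Sum>i=1..stages S. node S i ^ j * rat_eval (weight S i) x)
           - fact j / (- x) ^ (j + 1) * (exp (- x) - (\<Sum>l=0..j. (- x) ^ l / fact l)))
        \<in> O[at 0](\<lambda>x. x ^ (q - j)))"

definition strictly_stable_at_infinity :: "scheme \<Rightarrow> bool" where
  "strictly_stable_at_infinity S \<longleftrightarrow>
     (\<exists>L. (rat_eval (stability S) \<longlongrightarrow> L) at_top \<and> \<bar>L\<bar> < 1)"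

definition admissible_scheme :: "scheme \<Rightarrow> nat \<Rightarrow> bool" where
  "admissible_scheme S q \<longleftrightarrow>
     valid_nodes S \<and> stable_scheme S \<and> accurate_of_order S q \<and> strictly_stable_at_infinity S"

section \<open>Propagators and the parareal algorithm\<close>

definition propagator ::
  "'h::real_inner set \<Rightarrow> ('h \<Rightarrow> 'h) \<Rightarrow> scheme \<Rightarrow> real \<Rightarrow> real \<Rightarrow> 'h \<Rightarrow> (real \<Rightarrow> 'h) \<Rightarrow> 'h" where
  "propagator D A S t h v f =
     spectral_fun D A (\<lambda>\<mu>. rat_eval (stability S) (h * \<mu>)) v
     + h *\<^sub>R (\<Sum>i=1..stages S.
         spectral_fun D A (\<lambda>\<mu>. rat_eval (weight S i) (h * \<mu>)) (f (t + node S i * h)))"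

text \<open>\<open>n\<close> steps of length \<open>h\<close>, starting from \<open>v\<close> at time \<open>t\<close>.\<close>

primrec march ::
  "'h::real_inner set \<Rightarrow> ('h \<Rightarrow> 'h) \<Rightarrow> scheme \<Rightarrow> (real \<Rightarrow> 'h) \<Rightarrow> real \<Rightarrow> real \<Rightarrow> 'h \<Rightarrow> nat \<Rightarrow> 'h" where
  "march D A S f t h v 0 = v"
| "march D A S f t h v (Suc n) =
     propagator D A S (t + real n * h) h (march D A S f t h v n) f"

definition fine_solution ::
  "'h::real_inner set \<Rightarrow> ('h \<Rightarrow> 'h) \<Rightarrow> scheme \<Rightarrow> (real \<Rightarrow> 'h) \<Rightarrow> 'h \<Rightarrow> real \<Rightarrow> nat \<Rightarrow> 'h" where
  "fine_solution D A F f u0 dt n = march D A F f 0 dt u0 n"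

text \<open>
  \<open>parareal D A F G f u0 J dT dt k n\<close> is \<open>U\<^sup>n\<^sub>k\<close>. The term \<open>march ... J\<close> is the result of the fine
  inner iteration on the coarse interval starting at \<open>n * dT\<close>.
\<close>

fun parareal ::
  "'h::real_inner set \<Rightarrow> ('h \<Rightarrow> 'h) \<Rightarrow> scheme \<Rightarrow> scheme \<Rightarrow> (real \<Rightarrow> 'h) \<Rightarrow> 'h \<Rightarrow> nat \<Rightarrow> real \<Rightarrow> real
    \<Rightarrow> nat \<Rightarrow> nat \<Rightarrow> 'h" where
  "parareal D A F G f u0 J dT dt k 0 = u0"
| "parareal D A F G f u0 J dT dt 0 (Suc n) =
     propagator D A G (real n * dT) dT (parareal D A F G f u0 J dT dt 0 n) f"
| "parareal D A F G f u0 J dT dt (Suc k) (Suc n) =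
     propagator D A G (real n * dT) dT (parareal D A F G f u0 J dT dt (Suc k) n) f
     + march D A F f (real n * dT) dt (parareal D A F G f u0 J dT dt k n) J
     - propagator D A G (real n * dT) dT (parareal D A F G f u0 J dT dt k n) f"

text \<open>
  The set of which the supremum is taken is bounded above when the coarse scheme is admissible and
  \<open>\<Lambda>\<close> is bounded away from 0, so the supremum in the reals is the genuine one.
\<close>

definition kappa_c :: "ratfun \<Rightarrow> ratfun \<Rightarrow> nat \<Rightarrow> real set \<Rightarrow> real" where
  "kappa_c r R J \<Lambda> =
     (SUP s\<in>\<Lambda>. \<bar>(rat_eval r (s / real J) ^ J - rat_eval R s) / (1 - \<bar>rat_eval R s\<bar>)\<bar>)"

end

theory Submission
  imports Defs
begin

text \<open>
  Project orthogonally onto the eigenspace of each eigenvalue \<open>\<mu>\<close>. In such a mode the error \<open>e\<close> between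
  the parareal iterate and the fine solution satisfies \<open>e k 0 = 0\<close> and
  \<open>e (k+1) (n+1) = R e (k+1) n + (r\<^sup>J - R) e k n\<close>, with \<open>r\<close> and \<open>R\<close> evaluated at \<open>\<mu>\<close> times the step
  size. As \<open>\<bar>R\<bar> < 1\<close>, each iteration contracts the maximum over \<open>n\<close> by the factor
  \<open>\<bar>(r\<^sup>J - R) / (1 - \<bar>R\<bar>)\<bar>\<close>, which is at most \<open>\<kappa>\<^sub>c\<close>.

  By stability the initial error in the mode is at most
  \<open>2 \<bar>E\<^sub>\<mu> u\<^sup>0\<bar> + C sup\<^sub>t \<bar>E\<^sub>\<mu> f(t)\<bar>\<close>. The supremum is at most \<open>\<bar>E\<^sub>\<mu> f(0)\<bar> + \<integral> \<bar>E\<^sub>\<mu> f'\<bar>\<close>, which by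
  Minkowski's integral inequality is square summable over \<open>\<mu>\<close>, uniformly in the step sizes. All errors
  are sums of their projections, so completeness of the eigenvectors is not needed.
\<close>

section \<open>Orthogonal projections onto finite-dimensional subspaces\<close>

text \<open>Gram--Schmidt induction: only the component \<open>e\<close> of the new vector
  \<open>b\<close> orthogonal to \<open>span B\<close> enlarges the span, so the projection
  \<open>w\<close> is corrected along \<open>e\<close> alone.\<close>

lemma finite_span_orth_proj_exists:
  fixes B :: "'h::real_inner set"
  assumes "finite B"
  shows "\<exists>p\<in>span B. \<forall>y\<in>span B. inner (v - p) y = 0"
  using assms
proof (induction arbitrary: v rule: finite_induct)
  case empty
  then show ?case by simp
next
  case (insert b B)
  obtain p where p: "p \<in> span B" "\<And>y. y \<in> span B \<Longrightarrow> inner (b - p) y = 0"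
    using insert.IH by blast
  obtain w where w: "w \<in> span B" "\<And>y. y \<in> span B \<Longrightarrow> inner (v - w) y = 0"
    using insert.IH by blast
  define e where "e = b - p"
  have e: "inner e y = 0" if "y \<in> span B" for y
    using p(2) that by (simp add: e_def)
  have sub: "span B \<subseteq> span (insert b B)"
    by (rule span_mono) auto
  have e_in: "e \<in> span (insert b B)"
    unfolding e_def using p(1) sub by (intro span_diff) (auto intro: span_base)
  \<comment> \<open>For \<open>e = 0\<close>, where the quotient takes the default value 0, this is
    just \<open>q = w\<close>.\<close>
  define q where "q = w + (inner v e / inner e e) *\<^sub>R e"
  have "q \<in> span (insert b B)"
    unfolding q_def using w(1) sub e_in by (intro span_add span_scale) auto
  moreover have "inner (v - q) y = 0" if "y \<in> span (insert b B)" for y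
  proof -
    obtain k where "y - k *\<^sub>R b \<in> span B"
      using \<open>y \<in> span (insert b B)\<close> span_breakdown_eq by blast
    then have z: "y - k *\<^sub>R e \<in> span B"
      using span_add[OF _ span_scale[OF p(1), of k]]
      by (fastforce simp: e_def algebra_simps)
    have "inner (v - q) (y - k *\<^sub>R e) = 0"
      using w(2)[OF z] e[OF z] by (simp add: q_def inner_diff_left inner_add_left)
    moreover have "inner (v - q) e = 0"
    proof (cases "e = 0")
      case False
      then show ?thesis
        using e[OF w(1)]
        by (simp add: q_def inner_diff_left inner_diff_right inner_add_right inner_commute)
    qed simp
    ultimately show ?thesis
      by (simp add: inner_diff_right)
  qed
  ultimately show ?case
    by blast
qed

context
  fixes S :: "'h::real_inner set"
  assumes subspace: "subspace S" and dim_pos: "0 < dim S"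
begin

text \<open>An infinite basis has \<open>card\<close> 0, so \<open>0 < dim S\<close> gives a finite
  basis and with it existence. Two candidates differ by a vector of \<open>S\<close> orthogonal to
  itself, so the \<open>THE\<close> in \<open>orth_proj\<close> is well defined.\<close>

lemma orth_proj_props:
  shows orth_proj_in: "orth_proj S v \<in> S"
    and orth_proj_orthogonal: "y \<in> S \<Longrightarrow> inner (v - orth_proj S v) y = 0"
    and orth_proj_unique: "p \<in> S \<Longrightarrow> (\<And>y. y \<in> S \<Longrightarrow> inner (v - p) y = 0) \<Longrightarrow> orth_proj S v = p"
proof -
  obtain B where B: "B \<subseteq> S" "independent B" "S \<subseteq> span B" "card B = dim S"
    using basis_exists by blast
  have "finite B"
    using B(4) dim_pos card_gt_0_iff by metis
  moreover have "span B = S"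
    using B subspace span_subspace by blast
  ultimately obtain p where p: "p \<in> S" "\<forall>y\<in>S. inner (v - p) y = 0"
    using finite_span_orth_proj_exists[of B v] by auto
  have uniq: "p = q" if "p \<in> S" "\<forall>y\<in>S. inner (v - p) y = 0"
      "q \<in> S" "\<forall>y\<in>S. inner (v - q) y = 0" for p q
  proof -
    have "p - q \<in> S"
      using that subspace by (simp add: subspace_diff)
    then have "inner (v - q) (p - q) = 0" "inner (v - p) (p - q) = 0"
      using that by auto
    then have "inner (p - q) (p - q) = 0"
      by (simp add: inner_diff_left)
    then show "p = q"
      by simp
  qed
  have ex1: "\<exists>!p. p \<in> S \<and> (\<forall>y\<in>S. inner (v - p) y = 0)"
    using p uniq by blast
  show "orth_proj S v \<in> S"
    and "y \<in> S \<Longrightarrow> inner (v - orth_proj S v) y = 0"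
    unfolding orth_proj_def using theI'[OF ex1] by auto
  show "orth_proj S v = p" if "p \<in> S" "\<And>y. y \<in> S \<Longrightarrow> inner (v - p) y = 0" for p
    unfolding orth_proj_def using ex1 that by (intro the1_equality) auto
qed

lemma linear_orth_proj: "linear (orth_proj S)"
proof (rule linearI)
  show "orth_proj S (x + y) = orth_proj S x + orth_proj S y" for x y
  proof (rule orth_proj_unique)
    show "orth_proj S x + orth_proj S y \<in> S"
      using subspace orth_proj_in by (simp add: subspace_add)
    show "inner (x + y - (orth_proj S x + orth_proj S y)) z = 0" if "z \<in> S" for z
      using orth_proj_orthogonal[OF that, of x] orth_proj_orthogonal[OF that, of y]
      by (simp add: inner_diff_left inner_add_left)
  qed
  show "orth_proj S (c *\<^sub>R x) = c *\<^sub>R orth_proj S x" for c x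
  proof (rule orth_proj_unique)
    show "c *\<^sub>R orth_proj S x \<in> S"
      using subspace orth_proj_in by (simp add: subspace_scale)
    show "inner (c *\<^sub>R x - c *\<^sub>R orth_proj S x) z = 0" if "z \<in> S" for z
      using orth_proj_orthogonal[OF that, of x] by (simp add: inner_diff_left)
  qed
qed

lemma orth_proj_id: "x \<in> S \<Longrightarrow> orth_proj S x = x"
  by (rule orth_proj_unique) auto

lemma orth_proj_self_adjoint: "inner (orth_proj S x) y = inner x (orth_proj S y)"
  using orth_proj_orthogonal[OF orth_proj_in, of x y] orth_proj_orthogonal[OF orth_proj_in, of y x]
  by (simp add: inner_diff_left inner_diff_right inner_commute)

lemma orth_proj_eq_0: "(\<And>y. y \<in> S \<Longrightarrow> inner x y = 0) \<Longrightarrow> orth_proj S x = 0"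
  using subspace by (intro orth_proj_unique) (auto simp: subspace_0)

end

section \<open>Families of mutually orthogonal projections\<close>

locale orthogonal_projections =
  fixes I :: "'i set" and P :: "'i \<Rightarrow> 'h::{real_inner, banach, second_countable_topology} \<Rightarrow> 'h"
  assumes linear_P: "i \<in> I \<Longrightarrow> linear (P i)"
    and self_adjoint_P: "i \<in> I \<Longrightarrow> inner (P i x) y = inner x (P i y)"
    and idem_P: "i \<in> I \<Longrightarrow> P i (P i x) = P i x"
    and orth_P: "i \<in> I \<Longrightarrow> j \<in> I \<Longrightarrow> i \<noteq> j \<Longrightarrow> P i (P j x) = 0"
begin

lemma inner_P_P: "i \<in> I \<Longrightarrow> j \<in> I \<Longrightarrow> i \<noteq> j \<Longrightarrow> inner (P i x) (P j y) = 0"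
  by (simp add: self_adjoint_P orth_P)

lemma norm_sum_P:
  assumes "finite K" "K \<subseteq> I"
  shows "norm (\<Sum>i\<in>K. g i *\<^sub>R P i x) ^ 2 = (\<Sum>i\<in>K. (g i)^2 * norm (P i x) ^ 2)"
proof -
  have "pairwise (\<lambda>i j. orthogonal (g i *\<^sub>R P i x) (g j *\<^sub>R P j x)) K"
    using assms by (auto simp: pairwise_def orthogonal_def intro!: inner_P_P)
  then show ?thesis
    using norm_sum_Pythagorean[OF assms(1)] by (fastforce simp: power_mult_distrib)
qed

text \<open>For the partial sum \<open>s\<close>, self-adjointness and idempotence give
  \<open>inner x s = norm s ^ 2\<close>; expanding \<open>norm (x - s) ^ 2\<close> then yields the
  inequality.\<close>

lemma Bessel:
  assumes "finite K" "K \<subseteq> I"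
  shows "(\<Sum>i\<in>K. norm (P i x) ^ 2) \<le> norm x ^ 2"
proof -
  define s where "s = (\<Sum>i\<in>K. P i x)"
  have s: "norm s ^ 2 = (\<Sum>i\<in>K. norm (P i x) ^ 2)"
    using norm_sum_P[OF assms, of "\<lambda>_. 1" x] by (simp add: s_def)
  have "inner x (P i x) = norm (P i x) ^ 2" if "i \<in> K" for i
  proof -
    have "inner x (P i x) = inner x (P i (P i x))"
      using that assms by (simp add: idem_P subsetD)
    also have "\<dots> = inner (P i x) (P i x)"
      using that assms by (subst self_adjoint_P) auto
    finally show ?thesis
      by (simp add: power2_norm_eq_inner)
  qed
  then have "inner x s = norm s ^ 2"
    unfolding s by (simp add: s_def inner_sum_right)
  moreover have "0 \<le> norm (x - s) ^ 2"
    by simp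
  ultimately have "norm s ^ 2 \<le> norm x ^ 2"
    by (simp add: power2_norm_eq_inner inner_diff_left inner_diff_right inner_commute)
  then show ?thesis
    by (simp add: s)
qed

text \<open>Bessel's inequality in a form to which the triangle and Cauchy--Schwarz inequalities of
  \<open>L2_set\<close> apply. On an infinite \<open>K\<close> the value of \<open>L2_set\<close> is
  0.\<close>

lemma L2_set_norm_P_le:
  assumes "K \<subseteq> I"
  shows "L2_set (\<lambda>i. norm (P i x)) K \<le> norm x"
proof (cases "finite K")
  case True
  then show ?thesis
    unfolding L2_set_def using Bessel[OF True assms, of x] by (simp add: real_le_lsqrt)
qed simp

lemma norm_P_le: "i \<in> I \<Longrightarrow> norm (P i x) \<le> norm x"
  using L2_set_norm_P_le[of "{i}" x] by simp

lemma bounded_linear_P: "i \<in> I \<Longrightarrow> bounded_linear (P i)"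
  using linear_P norm_P_le
  by (intro bounded_linear_intro[where K = 1]) (auto simp: linear_add linear_scale)

text \<open>The squared norm \<open>Q K\<close> of a partial sum is additive over disjoint index
  sets and bounded. Once it is near its supremum, later blocks have small norm, so the net of
  partial sums is Cauchy and completeness gives the limit.\<close>

lemma summable_P:
  assumes g: "\<And>i. i \<in> I \<Longrightarrow> \<bar>g i\<bar> \<le> b"
  shows "(\<lambda>i. g i *\<^sub>R P i x) summable_on I"
proof -
  define f where "f i = g i *\<^sub>R P i x" for i
  define Q where "Q K = (\<Sum>i\<in>K. norm (f i) ^ 2)" for K
  have normf: "norm (sum f K) ^ 2 = Q K" if "finite K" "K \<subseteq> I" for K
    using norm_sum_P[OF that, of g x] by (simp add: f_def Q_def power_mult_distrib)
  have bound: "Q K \<le> b^2 * norm x ^ 2" if "finite K" "K \<subseteq> I" for K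
  proof -
    have "Q K \<le> (\<Sum>i\<in>K. b^2 * norm (P i x) ^ 2)"
      unfolding Q_def f_def
    proof (rule sum_mono)
      fix i assume "i \<in> K"
      then have "\<bar>g i\<bar>^2 \<le> b^2"
        using g that by (intro power_mono) auto
      then show "norm (g i *\<^sub>R P i x) ^ 2 \<le> b^2 * norm (P i x) ^ 2"
        by (simp add: power_mult_distrib mult_right_mono)
    qed
    also have "\<dots> \<le> b^2 * norm x ^ 2"
      unfolding sum_distrib_left[symmetric] by (intro mult_left_mono Bessel that) auto
    finally show ?thesis .
  qed
  define X where "X = Q ` {K. finite K \<and> K \<subseteq> I}"
  have X: "X \<noteq> {}" "bdd_above X"
    using bound by (auto simp: X_def intro!: bdd_aboveI)
  have "\<exists>R. eventually R (finite_subsets_at_top I) \<and>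
              (\<forall>K K'. R K \<and> R K' \<longrightarrow> dist (sum f K) (sum f K') < e)" if "e > 0" for e
  proof -
    \<comment> \<open>The margin is squared because \<open>Q\<close> measures squared norms; any two
      later sums are then within \<open>e/2\<close> of \<open>sum f K0\<close>.\<close>
    have "Sup X - (e/2)^2 < Sup X"
      using that by simp
    then obtain K0 where K0: "finite K0" "K0 \<subseteq> I" "Sup X - (e/2)^2 < Q K0"
      using less_cSup_iff[OF X] unfolding X_def by blast
    define R where "R K \<longleftrightarrow> finite K \<and> K0 \<subseteq> K \<and> K \<subseteq> I" for K
    have "eventually R (finite_subsets_at_top I)"
      using K0 by (auto simp: eventually_finite_subsets_at_top R_def)
    moreover have "dist (sum f K) (sum f K0) < e/2" if R: "R K" for K
    proof -
      have K: "finite K" "K0 \<subseteq> K" "K \<subseteq> I"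
        using R by (auto simp: R_def)
      have "norm (sum f (K - K0)) ^ 2 = Q (K - K0)"
        using K by (intro normf) auto
      also have "\<dots> = Q K - Q K0"
        using K by (simp add: Q_def sum_diff)
      also have "\<dots> < (e/2)^2"
        using K0 cSup_upper[OF _ X(2), of "Q K"] K by (force simp: X_def)
      finally have "norm (sum f (K - K0)) < e/2"
        using \<open>e > 0\<close> power_less_imp_less_base[of _ 2 "e/2"] by simp
      then show ?thesis
        using K by (simp add: dist_norm sum_diff)
    qed
    then have "dist (sum f K) (sum f K') < e" if "R K" "R K'" for K K'
      using that dist_triangle_half_l by blast
    ultimately show ?thesis
      by blast
  qed
  then have "cauchy_filter (filtermap (sum f) (finite_subsets_at_top I))"
    by (simp add: cauchy_filter_metric_filtermap)
  moreover have "complete (UNIV::'h set)"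
    by (meson Cauchy_convergent UNIV_I complete_def convergent_def)
  ultimately obtain L where "(sum f \<longlongrightarrow> L) (finite_subsets_at_top I)"
    using complete_uniform[where S = UNIV] by (force simp add: filterlim_def)
  then have "f summable_on I"
    using summable_on_def has_sum_def by blast
  then show ?thesis
    by (simp add: f_def[abs_def])
qed

text \<open>Membership in the closed span of the ranges of the \<open>P i\<close>. The norm of such
  a vector can be estimated from its projections; nothing of the kind is assumed of arbitrary
  vectors.\<close>

definition modal :: "'h \<Rightarrow> bool" where
  "modal x \<longleftrightarrow> ((\<lambda>i. P i x) has_sum x) I"

text \<open>Continuity carries \<open>P j\<close> through the sum, where orthogonality leaves one
  term. The terms are therefore the projections of the sum, which is modality.\<close>

lemma
  assumes g: "\<And>i. i \<in> I \<Longrightarrow> \<bar>g i\<bar> \<le> b"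
  shows P_infsum: "j \<in> I \<Longrightarrow> P j (\<Sum>\<^sub>\<infinity>i\<in>I. g i *\<^sub>R P i x) = g j *\<^sub>R P j x"
    and modal_infsum: "modal (\<Sum>\<^sub>\<infinity>i\<in>I. g i *\<^sub>R P i x)"
proof -
  define y where "y = (\<Sum>\<^sub>\<infinity>i\<in>I. g i *\<^sub>R P i x)"
  have y: "((\<lambda>i. g i *\<^sub>R P i x) has_sum y) I"
    unfolding y_def by (rule has_sum_infsum, rule summable_P, rule g)
  have Py: "P j y = g j *\<^sub>R P j x" if "j \<in> I" for j
  proof -
    have "((\<lambda>i. P j (g i *\<^sub>R P i x)) has_sum P j y) I"
      using has_sum_bounded_linear[OF bounded_linear_P[OF that] y] .
    moreover have "((\<lambda>i. P j (g i *\<^sub>R P i x)) has_sum P j (g j *\<^sub>R P j x)) I"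
      using that by (intro has_sum_finite_neutralI[of "{j}"])
        (auto simp: linear_scale[OF linear_P] orth_P)
    ultimately show ?thesis
      using has_sum_unique that by (fastforce simp: linear_scale[OF linear_P] idem_P)
  qed
  show "P j (\<Sum>\<^sub>\<infinity>i\<in>I. g i *\<^sub>R P i x) = g j *\<^sub>R P j x" if "j \<in> I"
    using Py that by (simp add: y_def)
  show "modal (\<Sum>\<^sub>\<infinity>i\<in>I. g i *\<^sub>R P i x)"
    unfolding modal_def y_def[symmetric] using y Py by (simp cong: has_sum_cong)
qed

lemma modal_0: "modal 0"
  using linear_0[OF linear_P] by (simp add: modal_def has_sum_0)

lemma modal_add: "modal x \<Longrightarrow> modal y \<Longrightarrow> modal (x + y)"
  unfolding modal_def using has_sum_add[of "\<lambda>i. P i x" I x "\<lambda>i. P i y" y]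
  by (simp add: linear_add[OF linear_P] cong: has_sum_cong)

lemma modal_scaleR: "modal x \<Longrightarrow> modal (c *\<^sub>R x)"
  unfolding modal_def using has_sum_scaleR[of "\<lambda>i. P i x" I x c]
  by (simp add: linear_scale[OF linear_P] cong: has_sum_cong)

lemma modal_diff: "modal x \<Longrightarrow> modal y \<Longrightarrow> modal (x - y)"
  using modal_add[of x "(-1) *\<^sub>R y"] modal_scaleR[of y "-1"] by simp

lemma modal_sum: "(\<And>k. k \<in> K \<Longrightarrow> modal (h k)) \<Longrightarrow> modal (sum h K)"
  by (induction K rule: infinite_finite_induct) (auto simp: modal_0 modal_add)

text \<open>By Pythagoras the norm of a partial sum is the \<open>L2_set\<close> of its terms, and
  the bound survives the limit. This turns estimates in single modes into estimates in the Hilbert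
  space.\<close>

lemma norm_modal_le:
  assumes "modal x" and "\<And>K. finite K \<Longrightarrow> K \<subseteq> I \<Longrightarrow> L2_set (\<lambda>i. norm (P i x)) K \<le> C"
  shows "norm x \<le> C"
proof (rule tendsto_upperbound)
  show "((\<lambda>K. norm (\<Sum>i\<in>K. P i x)) \<longlongrightarrow> norm x) (finite_subsets_at_top I)"
    using assms(1) unfolding modal_def has_sum_def by (rule tendsto_norm)
  have "norm (\<Sum>i\<in>K. P i x) \<le> C" if "finite K" "K \<subseteq> I" for K
  proof -
    have "norm (\<Sum>i\<in>K. P i x) = L2_set (\<lambda>i. norm (P i x)) K"
      unfolding L2_set_def
      using norm_sum_P[OF that, of "\<lambda>_. 1" x] by (simp add: real_sqrt_unique)
    then show ?thesis
      using assms(2)[OF that] by simp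
  qed
  then show "eventually (\<lambda>K. norm (\<Sum>i\<in>K. P i x) \<le> C) (finite_subsets_at_top I)"
    by (intro eventually_finite_subsets_at_top_weakI)
qed simp

text \<open>
  Writing \<open>m i\<close> for the integral on the left, the sum of the
  \<open>(m i)\<^sup>2\<close> is the integral of the sum of \<open>m i * norm (P i (w t))\<close>; apply the Cauchy--Schwarz
  inequality under the integral and cancel.
\<close>

lemma L2_set_integral_norm_P_le:
  fixes w :: "real \<Rightarrow> 'h"
  assumes w: "integrable M w" and K: "K \<subseteq> I"
  shows "L2_set (\<lambda>i. \<integral>t. norm (P i (w t)) \<partial>M) K \<le> (\<integral>t. norm (w t) \<partial>M)"
proof (cases "finite K")
  case True
  define m where "m i = (\<integral>t. norm (P i (w t)) \<partial>M)" for i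
  have int: "integrable M (\<lambda>t. norm (P i (w t)))" if "i \<in> K" for i
    using that K by (intro integrable_norm integrable_bounded_linear[OF bounded_linear_P] w) auto
  have "L2_set m K * L2_set m K = (\<Sum>i\<in>K. m i * m i)"
    by (simp add: L2_set_def sum_nonneg flip: power2_eq_square)
  also have "\<dots> = (\<integral>t. (\<Sum>i\<in>K. m i * norm (P i (w t))) \<partial>M)"
    using int by (simp add: m_def)
  also have "\<dots> \<le> (\<integral>t. L2_set m K * norm (w t) \<partial>M)"
  proof (rule integral_mono)
    fix t
    have "(\<Sum>i\<in>K. m i * norm (P i (w t))) \<le> L2_set m K * L2_set (\<lambda>i. norm (P i (w t))) K"
      using L2_set_mult_ineq[of m "\<lambda>i. norm (P i (w t))" K] by (simp add: m_def)
    also have "\<dots> \<le> L2_set m K * norm (w t)"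
      using L2_set_norm_P_le[OF K] by (intro mult_left_mono) auto
    finally show "(\<Sum>i\<in>K. m i * norm (P i (w t))) \<le> L2_set m K * norm (w t)" .
  qed (use int w in auto)
  finally have "L2_set m K * L2_set m K \<le> L2_set m K * (\<integral>t. norm (w t) \<partial>M)"
    by simp
  then show ?thesis
    unfolding m_def[symmetric, abs_def]
    by (cases "L2_set m K = 0") (auto simp: order.strict_iff_order mult_le_cancel_left)
qed simp

end

section \<open>Eigenvalues and eigenspaces\<close>

lemma self_adjoint_symmetric:
  assumes "self_adjoint D A" "x \<in> D" "y \<in> D"
  shows "inner (A x) y = inner x (A y)"
  using assms unfolding self_adjoint_def by blast

lemma subspace_eigenspace:
  assumes "densely_defined_linear D A"
  shows "subspace (eigenspace D A \<mu>)"
proof -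
  have D: "subspace D" and add: "\<And>x y. x \<in> D \<Longrightarrow> y \<in> D \<Longrightarrow> A (x + y) = A x + A y"
    and scale: "\<And>a x. x \<in> D \<Longrightarrow> A (a *\<^sub>R x) = a *\<^sub>R A x"
    using assms unfolding densely_defined_linear_def by auto
  have "A 0 = 0"
    using scale[of 0 0] D by (simp add: subspace_0)
  then show ?thesis
    unfolding subspace_def eigenspace_def using D
    by (auto simp: add scale scaleR_right_distrib subspace_0 subspace_add subspace_scale)
qed

text \<open>Symmetry gives \<open>\<mu> * inner x y = \<nu> * inner x y\<close>.\<close>

lemma eigenspaces_orthogonal:
  assumes "self_adjoint D A" "x \<in> eigenspace D A \<mu>" "y \<in> eigenspace D A \<nu>" "\<mu> \<noteq> \<nu>"
  shows "inner x y = 0"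
  using self_adjoint_symmetric[OF assms(1), of x y] assms by (simp add: eigenspace_def)

lemma eigenvalue_ge:
  assumes "eigenvalue_sequence D A lam" "\<mu> \<in> eigenvalues D A"
  shows "lam 0 \<le> \<mu>"
proof -
  obtain j where "\<mu> = lam j"
    using assms unfolding eigenvalue_sequence_def by blast
  then show ?thesis
    using assms unfolding eigenvalue_sequence_def incseq_def by simp
qed

text \<open>Supplies the finite dimension that the projections rest on. As \<open>lam\<close>
  diverges, only finitely many indices carry \<open>\<mu>\<close>, so the multiplicity is a true
  count and not the default 0 of an infinite set.\<close>

lemma dim_eigenspace_pos:
  assumes "eigenvalue_sequence D A lam" "\<mu> \<in> eigenvalues D A"
  shows "0 < dim (eigenspace D A \<mu>)"
proof -
  have "eventually (\<lambda>j. lam j > \<mu>) sequentially"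
    using assms unfolding eigenvalue_sequence_def filterlim_at_top_dense by blast
  then obtain N where "\<And>j. j \<ge> N \<Longrightarrow> lam j > \<mu>"
    by (auto simp: eventually_sequentially)
  then have "{j. lam j = \<mu>} \<subseteq> {..<N}"
    by (metis (mono_tags, lifting) lessThan_iff linorder_not_le mem_Collect_eq order_less_irrefl subsetI)
  then have "finite {j. lam j = \<mu>}"
    by (rule finite_subset) simp
  moreover have "\<mu> \<in> range lam"
    using assms unfolding eigenvalue_sequence_def by blast
  then have "{j. lam j = \<mu>} \<noteq> {}"
    by auto
  ultimately have "0 < card {j. lam j = \<mu>}"
    by (simp add: card_gt_0_iff)
  then show ?thesis
    using assms(1) unfolding eigenvalue_sequence_def by simp
qed

section \<open>Single step schemes in one mode\<close>

lemma abs_stability_le: "stable_scheme S \<Longrightarrow> x > 0 \<Longrightarrow> \<bar>rat_eval (stability S) x\<bar> \<le> 1"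
  unfolding stable_scheme_def by fastforce

lemma weight_bound:
  assumes "stable_scheme S"
  obtains c where "0 \<le> c" "\<And>x i. x > 0 \<Longrightarrow> i \<in> {1..stages S} \<Longrightarrow> \<bar>rat_eval (weight S i) x\<bar> \<le> c"
proof -
  obtain c where c: "\<forall>x>0. \<forall>i\<in>{1..stages S}. \<bar>rat_eval (weight S i) x\<bar> < c"
    using assms unfolding stable_scheme_def by blast
  show thesis
    \<comment> \<open>Without stages the constant in \<open>stable_scheme\<close> may be negative,
      hence the maximum with 0.\<close>
    using c by (intro that[of "max c 0"]) (auto intro: less_imp_le simp: le_max_iff_disj)
qed

locale discrete_spectrum =
  fixes D :: "'h::{real_inner, banach, second_countable_topology} set" and A :: "'h \<Rightarrow> 'h"
    and lam :: "nat \<Rightarrow> real"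
  assumes linear_A: "densely_defined_linear D A"
    and self_adjoint_A: "self_adjoint D A"
    and lam: "eigenvalue_sequence D A lam"
begin

abbreviation E :: "real \<Rightarrow> 'h \<Rightarrow> 'h" where
  "E \<mu> \<equiv> orth_proj (eigenspace D A \<mu>)"

text \<open>The index set consists of the distinct eigenvalues: multiplicities are absorbed into the
  eigenspaces, whose mutual orthogonality makes the products of projections vanish.\<close>

sublocale orthogonal_projections "eigenvalues D A" E
proof (rule orthogonal_projections.intro)
  fix \<mu> \<nu> :: real and x y :: 'h
  assume \<mu>: "\<mu> \<in> eigenvalues D A"
  note props = subspace_eigenspace[OF linear_A] dim_eigenspace_pos[OF lam]
  show "linear (E \<mu>)"
    using props \<mu> by (intro linear_orth_proj)
  show "inner (E \<mu> x) y = inner x (E \<mu> y)"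
    using props \<mu> by (intro orth_proj_self_adjoint)
  show "E \<mu> (E \<mu> x) = E \<mu> x"
    using props \<mu> by (intro orth_proj_id orth_proj_in)
  show "E \<mu> (E \<nu> x) = 0" if "\<nu> \<in> eigenvalues D A" "\<mu> \<noteq> \<nu>"
  proof (rule orth_proj_eq_0)
    have "E \<nu> x \<in> eigenspace D A \<nu>"
      using props that by (intro orth_proj_in)
    then show "inner (E \<nu> x) y = 0" if "y \<in> eigenspace D A \<mu>" for y
      using eigenspaces_orthogonal[OF self_adjoint_A] that \<open>\<mu> \<noteq> \<nu>\<close> by blast
  qed (use props \<mu> in auto)
qed

lemma eigenvalue_pos: "\<mu> \<in> eigenvalues D A \<Longrightarrow> 0 < \<mu>"
  using eigenvalue_ge[OF lam] lam unfolding eigenvalue_sequence_def by fastforce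

context
  fixes S :: scheme
  assumes stable: "stable_scheme S"
begin

text \<open>As \<open>h * \<nu> > 0\<close> for every eigenvalue \<open>\<nu>\<close>, the bounds 1
  and \<open>c\<close> for the stability function and the weights hold on the scaled spectrum. The
  spectral sums thus converge, and each mode sees the scheme with scalar coefficients.\<close>

lemma
  assumes "h > 0"
  shows E_propagator: "\<mu> \<in> eigenvalues D A \<Longrightarrow> E \<mu> (propagator D A S t h v f) =
      rat_eval (stability S) (h * \<mu>) *\<^sub>R E \<mu> v
      + h *\<^sub>R (\<Sum>i=1..stages S. rat_eval (weight S i) (h * \<mu>) *\<^sub>R E \<mu> (f (t + node S i * h)))"
    and modal_propagator: "modal (propagator D A S t h v f)"
proof -
  have pos: "0 < h * \<nu>" if "\<nu> \<in> eigenvalues D A" for \<nu>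
    using that assms eigenvalue_pos by simp
  obtain c where c: "0 \<le> c" "\<And>x i. x > 0 \<Longrightarrow> i \<in> {1..stages S} \<Longrightarrow> \<bar>rat_eval (weight S i) x\<bar> \<le> c"
    using weight_bound[OF stable] by blast
  note stab = abs_stability_le[OF stable pos]
  show "modal (propagator D A S t h v f)"
    unfolding propagator_def spectral_fun_def
    using stab pos c(2)
    by (intro modal_add modal_scaleR modal_sum modal_infsum[where b = 1] modal_infsum[where b = c]) auto
  assume \<mu>: "\<mu> \<in> eigenvalues D A"
  have "E \<mu> (spectral_fun D A (\<lambda>\<mu>. rat_eval (stability S) (h * \<mu>)) v)
      = rat_eval (stability S) (h * \<mu>) *\<^sub>R E \<mu> v"
    unfolding spectral_fun_def using stab \<mu> by (intro P_infsum[where b = 1])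
  moreover have "E \<mu> (spectral_fun D A (\<lambda>\<mu>. rat_eval (weight S i) (h * \<mu>)) w)
      = rat_eval (weight S i) (h * \<mu>) *\<^sub>R E \<mu> w" if "i \<in> {1..stages S}" for i w
    unfolding spectral_fun_def using pos c(2) \<mu> that by (intro P_infsum[where b = c]) auto
  ultimately show "E \<mu> (propagator D A S t h v f) =
      rat_eval (stability S) (h * \<mu>) *\<^sub>R E \<mu> v
      + h *\<^sub>R (\<Sum>i=1..stages S. rat_eval (weight S i) (h * \<mu>) *\<^sub>R E \<mu> (f (t + node S i * h)))"
    unfolding propagator_def
    by (simp add: linear_add linear_scale linear_sum linear_P[OF \<mu>])
qed

text \<open>The starting value is arbitrary, so at least one step is required: modality comes from
  the last application of the propagator.\<close>

lemma modal_march: "h > 0 \<Longrightarrow> 0 < n \<Longrightarrow> modal (march D A S f t h v n)"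
  by (cases n) (auto intro: modal_propagator)

text \<open>The source contributes equally to both marches and cancels.\<close>

lemma E_march_diff:
  assumes "h > 0" "\<mu> \<in> eigenvalues D A"
  shows "E \<mu> (march D A S f t h v n) - E \<mu> (march D A S f t h w n)
    = rat_eval (stability S) (h * \<mu>) ^ n *\<^sub>R (E \<mu> v - E \<mu> w)"
proof (induction n)
  case (Suc n)
  have "E \<mu> (march D A S f t h v (Suc n)) - E \<mu> (march D A S f t h w (Suc n))
      = rat_eval (stability S) (h * \<mu>) *\<^sub>R (E \<mu> (march D A S f t h v n) - E \<mu> (march D A S f t h w n))"
    by (simp add: E_propagator[OF assms] scaleR_diff_right)
  then show ?case
    by (simp add: Suc)
qed simp

text \<open>The stability factor has modulus at most 1, so each step adds at most
  \<open>h * (real (stages S) * c * b)\<close>. Nodes in the unit interval keep all samples of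
  \<open>f\<close> inside \<open>{0..T}\<close>.\<close>

lemma norm_E_march_le:
  assumes h: "h > 0" and \<mu>: "\<mu> \<in> eigenvalues D A" and nodes: "valid_nodes S"
    and c: "\<And>x i. x > 0 \<Longrightarrow> i \<in> {1..stages S} \<Longrightarrow> \<bar>rat_eval (weight S i) x\<bar> \<le> c" "0 \<le> c"
    and b: "\<And>\<tau>. \<tau> \<in> {0..T} \<Longrightarrow> norm (E \<mu> (f \<tau>)) \<le> b"
    and "0 \<le> t" "t + real n * h \<le> T"
  shows "norm (E \<mu> (march D A S f t h v n)) \<le> norm (E \<mu> v) + real n * h * (real (stages S) * c * b)"
  using \<open>t + real n * h \<le> T\<close>
proof (induction n)
  case (Suc n)
  have hmu: "0 < h * \<mu>"
    using h eigenvalue_pos[OF \<mu>] by simp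
  define s where "s = t + real n * h"
  have s: "0 \<le> s" "s + h \<le> T"
    using \<open>0 \<le> t\<close> h Suc.prems by (auto simp: s_def algebra_simps)
  define x where "x = march D A S f t h v n"
  define z where
    "z = (\<Sum>i=1..stages S. rat_eval (weight S i) (h * \<mu>) *\<^sub>R E \<mu> (f (s + node S i * h)))"
  have "norm z
      \<le> (\<Sum>i=1..stages S. c * b)"
    unfolding z_def
  proof (rule order_trans[OF norm_sum], rule sum_mono)
    fix i assume i: "i \<in> {1..stages S}"
    then have "node S i \<in> {0..1}"
      using nodes unfolding valid_nodes_def by blast
    then have "0 \<le> node S i * h" "node S i * h \<le> h"
      using h by (auto simp: mult_left_le_one_le)
    then have "s + node S i * h \<in> {0..T}"
      using s by auto
    then show "norm (rat_eval (weight S i) (h * \<mu>) *\<^sub>R E \<mu> (f (s + node S i * h))) \<le> c * b"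
      using c(1)[OF hmu i] \<open>0 \<le> c\<close> b by (auto intro!: mult_mono)
  qed
  then have "norm (h *\<^sub>R z)
      \<le> h * (real (stages S) * c * b)"
    using h by (simp add: mult.assoc)
  moreover have "norm (rat_eval (stability S) (h * \<mu>) *\<^sub>R E \<mu> x) \<le> norm (E \<mu> x)"
    using abs_stability_le[OF stable hmu] by (simp add: mult_left_le_one_le)
  moreover have "norm (E \<mu> x) \<le> norm (E \<mu> v) + real n * h * (real (stages S) * c * b)"
    using Suc h unfolding x_def by (auto simp: algebra_simps)
  moreover have "norm (E \<mu> (march D A S f t h v (Suc n)))
      \<le> norm (rat_eval (stability S) (h * \<mu>) *\<^sub>R E \<mu> x) + norm (h *\<^sub>R z)"
    unfolding march.simps E_propagator[OF h \<mu>] x_def s_def z_def by (rule norm_triangle_ineq)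
  moreover have "real (Suc n) * h * (real (stages S) * c * b)
      = real n * h * (real (stages S) * c * b) + h * (real (stages S) * c * b)"
    by (simp add: algebra_simps)
  ultimately show ?case
    by linarith
qed simp

end

end

section \<open>Propagation of the parareal error\<close>

lemma march_add:
  "march D A S f t h v (m + n) = march D A S f (t + real m * h) h (march D A S f t h v m) n"
  by (induction n) (auto simp: algebra_simps)

lemma parareal_0_eq_march:
  "parareal D A F G f u0 J dT dt 0 n = march D A G f 0 dT u0 n"
  by (induction n) auto

text \<open>The number \<open>k = \<bar>d\<bar> / (1 - \<bar>R\<bar>)\<close> solves
  \<open>k = \<bar>R\<bar> * k + \<bar>d\<bar>\<close>, so the level \<open>k * m\<close> reproduces
  itself from one step to the next, uniformly in \<open>n\<close>.\<close>

lemma forced_contraction_bound: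
  fixes a b :: "nat \<Rightarrow> 'a::real_normed_vector"
  assumes "a 0 = 0" and step: "\<And>n. a (Suc n) = R *\<^sub>R a n + d *\<^sub>R b n"
    and "\<bar>R\<bar> < 1" "0 \<le> m" and b: "\<And>n. n \<le> N \<Longrightarrow> norm (b n) \<le> m" and "n \<le> N"
  shows "norm (a n) \<le> \<bar>d / (1 - \<bar>R\<bar>)\<bar> * m"
  using \<open>n \<le> N\<close>
proof (induction n)
  case 0
  then show ?case
    using assms by simp
next
  case (Suc n)
  define k where "k = \<bar>d\<bar> / (1 - \<bar>R\<bar>)"
  have k: "\<bar>d / (1 - \<bar>R\<bar>)\<bar> = k" "\<bar>d\<bar> = k * (1 - \<bar>R\<bar>)"
    using assms by (auto simp: k_def)
  have "norm (a (Suc n)) \<le> \<bar>R\<bar> * norm (a n) + \<bar>d\<bar> * norm (b n)"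
    unfolding step by (rule norm_triangle_mono) auto
  also have "norm (a n) \<le> k * m"
    using Suc.IH Suc.prems unfolding k(1) by auto
  also have "norm (b n) \<le> m"
    using b Suc.prems by auto
  finally have "norm (a (Suc n)) \<le> \<bar>R\<bar> * (k * m) + \<bar>d\<bar> * m"
    by (simp add: mult_left_mono)
  also have "\<dots> = k * m"
    by (simp add: k(2) algebra_simps)
  finally show ?case
    unfolding k(1) .
qed

context discrete_spectrum
begin

text \<open>The source cancels twice. The two coarse propagators leave \<open>R\<close> times the
  difference of the iterates; the fine march of the correction, compared with the fine solution
  restarted at the coarse time, leaves \<open>r^J\<close> times the old error.\<close>

lemma E_parareal_error_Suc:
  fixes u0 :: 'h and f :: "real \<Rightarrow> 'h"
  assumes F: "stable_scheme F" and G: "stable_scheme G"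
    and dt: "dt > 0" and dT: "dT = real J * dt" and J: "J \<ge> 1" and \<mu>: "\<mu> \<in> eigenvalues D A"
  defines "e \<equiv> \<lambda>k n. parareal D A F G f u0 J dT dt k n - fine_solution D A F f u0 dt (n * J)"
  shows "E \<mu> (e (Suc k) (Suc n)) = rat_eval (stability G) (dT * \<mu>) *\<^sub>R E \<mu> (e (Suc k) n)
    + (rat_eval (stability F) (dt * \<mu>) ^ J - rat_eval (stability G) (dT * \<mu>)) *\<^sub>R E \<mu> (e k n)"
proof -
  have pos: "dT > 0"
    using dt J dT by simp
  note lin = linear_add[OF linear_P[OF \<mu>]] linear_diff[OF linear_P[OF \<mu>]]
  have "fine_solution D A F f u0 dt (Suc n * J)
      = march D A F f (real n * dT) dt (fine_solution D A F f u0 dt (n * J)) J"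
    using march_add[of D A F f 0 dt u0 "n * J" J]
    by (simp add: fine_solution_def dT mult.assoc add.commute)
  then show ?thesis
    using E_march_diff[OF F dt \<mu>, of f "real n * dT" "parareal D A F G f u0 J dT dt k n" J
        "fine_solution D A F f u0 dt (n * J)"]
    by (simp add: e_def lin E_propagator[OF G pos \<mu>] algebra_simps)
qed

text \<open>At \<open>n = 0\<close> the error is 0, whatever \<open>u0\<close> is. For later
  \<open>n\<close> every term is a propagator value or a march of positive length, where
  \<open>J \<ge> 1\<close> enters.\<close>

lemma modal_parareal_error:
  assumes F: "stable_scheme F" and G: "stable_scheme G" and "dt > 0" "dT > 0" "J \<ge> 1"
  shows "modal (parareal D A F G f u0 J dT dt k n - fine_solution D A F f u0 dt (n * J))"
proof (cases n)
  case 0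
  then show ?thesis
    by (simp add: fine_solution_def modal_0)
next
  case (Suc m)
  have "modal (parareal D A F G f u0 J dT dt k (Suc m))"
    using assms
    by (cases k) (auto intro!: modal_add modal_diff modal_propagator[OF G] modal_march[OF F])
  moreover have "modal (fine_solution D A F f u0 dt (n * J))"
    unfolding fine_solution_def using assms Suc by (intro modal_march[OF F]) auto
  ultimately show ?thesis
    using Suc by (intro modal_diff) auto
qed

text \<open>Induction on \<open>k\<close>: the error of iterate \<open>k\<close> drives that of
  iterate \<open>Suc k\<close>, and \<open>forced_contraction_bound\<close> gains one factor
  \<open>\<kappa>\<close>.\<close>

lemma norm_E_parareal_error_le:
  assumes F: "stable_scheme F" and G: "stable_scheme G"
    and dt: "dt > 0" and dT: "dT = real J * dt" and J: "J \<ge> 1" and \<mu>: "\<mu> \<in> eigenvalues D A"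
    and \<kappa>: "\<bar>(rat_eval (stability F) (dt * \<mu>) ^ J - rat_eval (stability G) (dT * \<mu>))
        / (1 - \<bar>rat_eval (stability G) (dT * \<mu>)\<bar>)\<bar> \<le> \<kappa>"
    and m: "\<And>n. n \<le> N \<Longrightarrow> norm (E \<mu> (parareal D A F G f u0 J dT dt 0 n
        - fine_solution D A F f u0 dt (n * J))) \<le> m"
    and "n \<le> N"
  shows "norm (E \<mu> (parareal D A F G f u0 J dT dt k n - fine_solution D A F f u0 dt (n * J))) \<le> \<kappa> ^ k * m"
  using \<open>n \<le> N\<close>
proof (induction k arbitrary: n)
  case 0
  then show ?case
    using m by simp
next
  case (Suc k)
  have m0: "0 \<le> m"
    using m[of 0] norm_ge_zero order_trans by blast
  have \<kappa>0: "0 \<le> \<kappa>"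
    using \<kappa> by linarith
  have "dT * \<mu> > 0"
    using dt J dT eigenvalue_pos[OF \<mu>] by simp
  then have R: "\<bar>rat_eval (stability G) (dT * \<mu>)\<bar> < 1"
    using G unfolding stable_scheme_def by blast
  have "norm (E \<mu> (parareal D A F G f u0 J dT dt (Suc k) n - fine_solution D A F f u0 dt (n * J)))
      \<le> \<bar>(rat_eval (stability F) (dt * \<mu>) ^ J - rat_eval (stability G) (dT * \<mu>))
        / (1 - \<bar>rat_eval (stability G) (dT * \<mu>)\<bar>)\<bar> * (\<kappa> ^ k * m)"
  proof (rule forced_contraction_bound[where N = N and a = "\<lambda>n. E \<mu> (parareal D A F G f u0 J dT dt (Suc k) n
        - fine_solution D A F f u0 dt (n * J))" and b = "\<lambda>n. E \<mu> (parareal D A F G f u0 J dT dt k n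
        - fine_solution D A F f u0 dt (n * J))"])
    show "E \<mu> (parareal D A F G f u0 J dT dt (Suc k) 0 - fine_solution D A F f u0 dt (0 * J)) = 0"
      using linear_0[OF linear_P[OF \<mu>]] by (simp add: fine_solution_def)
  qed (use E_parareal_error_Suc[OF F G dt dT J \<mu>] R Suc m0 \<kappa>0 in auto)
  also have "\<dots> \<le> \<kappa> * (\<kappa> ^ k * m)"
    using \<kappa> m0 \<kappa>0 by (intro mult_right_mono) auto
  finally show ?case
    by (simp add: mult.assoc)
qed

end

section \<open>Bounding the source uniformly in time\<close>

text \<open>One function \<open>w\<close>, the derivative of \<open>f\<close> cut off outside
  \<open>{0..T}\<close>, serves all \<open>L\<close> and \<open>t\<close>. For a spectral projection
  \<open>L\<close> the right-hand side is free of \<open>t\<close>, so it can be summed in square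
  over the modes.\<close>

lemma source_projection_bound:
  fixes f :: "real \<Rightarrow> 'h::{real_inner, banach, second_countable_topology}"
  assumes reg: "source_regular D A T q f" and "q \<ge> 1" and "T > 0"
  obtains w :: "real \<Rightarrow> 'h" where "integrable lebesgue w"
    and "\<And>L t. bounded_linear (L :: 'h \<Rightarrow> 'h) \<Longrightarrow> t \<in> {0..T} \<Longrightarrow>
      norm (L (f t)) \<le> norm (L (f 0)) + (LINT s|lebesgue. norm (L (w s)))"
proof -
  obtain df where df:
    "(\<forall>t\<in>{0..T}. df 0 t = f t) \<and>
     (\<forall>l. Suc l < q \<longrightarrow>
        (\<forall>t\<in>{0..T}. (df l has_vector_derivative df (Suc l) t) (at t within {0..T}))) \<and>
     (\<forall>l<q. continuous_into_pow_domain D A (q - l) T (df l)) \<and>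
     set_integrable lebesgue {0..T} (df q) \<and>
     (\<forall>l. Suc l = q \<longrightarrow>
        (\<forall>t\<in>{0..T}. df l t = df l 0 + (LINT s:{0..t}|lebesgue. df q s)))"
    using reg unfolding source_regular_def by (rule exE)
  note df0 = df[THEN conjunct1, rule_format]
    and deriv = df[THEN conjunct2, THEN conjunct1, rule_format]
    and cont = df[THEN conjunct2, THEN conjunct2, THEN conjunct1, rule_format]
    and int = df[THEN conjunct2, THEN conjunct2, THEN conjunct2, THEN conjunct1]
    and primitive = df[THEN conjunct2, THEN conjunct2, THEN conjunct2, THEN conjunct2, rule_format]
  define w where "w = (\<lambda>s. indicator {0..T} s *\<^sub>R df 1 s)"
  have cont1: "continuous_on {0..T} (df 1)" if "1 < q"
  proof -
    have "continuous_on {0..T} (\<lambda>t. (A ^^ 0) (df 1 t))"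
      using cont[OF that] unfolding continuous_into_pow_domain_def by blast
    then show ?thesis
      by simp
  qed
  have w: "integrable lebesgue w"
  proof (cases "q = 1")
    case True
    then show ?thesis
      using int by (simp add: w_def set_integrable_def)
  next
    case False
    then have "integrable lborel w"
      using borel_integrable_atLeastAtMost'[OF cont1] \<open>q \<ge> 1\<close> by (simp add: w_def set_integrable_def)
    then show ?thesis
      by (simp add: integrable_completion)
  qed
  have "norm (L (f t) - L (f 0)) \<le> (LINT s|lebesgue. norm (L (w s)))"
    if L: "bounded_linear (L :: 'h \<Rightarrow> 'h)" and t: "t \<in> {0..T}" for L t
  proof -
    interpret L: bounded_linear L
      by (rule L)
    have Lw: "integrable lebesgue (\<lambda>s. norm (L (w s)))"
      by (intro integrable_norm integrable_bounded_linear[OF L] w)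
    have eq: "L (f t) - L (f 0) = L (df 0 t - df 0 0)"
      using df0 t \<open>T > 0\<close> by (simp add: L.diff)
    show ?thesis
    \<comment> \<open>For \<open>q = 1\<close> the derivative is merely integrable and the increment
      comes from the Bochner primitive; for \<open>q > 1\<close> it is continuous and the
      fundamental theorem of calculus applies.\<close>
    proof (cases "q = 1")
      case True
      define wt where "wt = (\<lambda>s. indicator {0..t} s *\<^sub>R df 1 s)"
      have "set_integrable lebesgue {0..t} (df q)"
        using t by (intro set_integrable_subset[OF int]) auto
      then have wt: "integrable lebesgue wt"
        by (simp add: wt_def set_integrable_def True)
      have "df 0 t - df 0 0 = (LINT s|lebesgue. wt s)"
        using primitive[of 0 t] True t by (simp add: wt_def set_lebesgue_integral_def)
      then have "norm (L (f t) - L (f 0)) = norm (LINT s|lebesgue. L (wt s))"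
        unfolding eq using integral_bounded_linear[OF L wt] by simp
      also have "\<dots> \<le> (LINT s|lebesgue. norm (L (wt s)))"
        by (rule integral_norm_bound)
      also have "\<dots> \<le> (LINT s|lebesgue. norm (L (w s)))"
        using t by (intro integral_mono integrable_norm integrable_bounded_linear[OF L] wt w)
          (auto simp: wt_def w_def L.scaleR L.zero split: split_indicator)
      finally show ?thesis .
    next
      case False
      then have q: "1 < q"
        using \<open>q \<ge> 1\<close> by simp
      have cont': "continuous_on {0..T} (\<lambda>s. norm (L (df 1 s)))"
        using cont1[OF q] by (intro continuous_on_norm L.continuous_on)
      \<comment> \<open>This is a gauge integral of a vector-valued function; the passage to the
        Lebesgue integral is made later, for the real function
        \<open>norm (L (df 1 s))\<close>.\<close>
      have "((\<lambda>s. L (df 1 s)) has_integral L (df 0 t) - L (df 0 0)) {0..t}"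
      proof (rule fundamental_theorem_of_calculus)
        fix s assume s: "s \<in> {0..t}"
        have "(df 0 has_vector_derivative df 1 s) (at s within {0..t})"
          using deriv[of 0 s] q s t by (auto intro: has_vector_derivative_within_subset)
        then show "((\<lambda>s. L (df 0 s)) has_vector_derivative L (df 1 s)) (at s within {0..t})"
          by (rule L.has_vector_derivative)
      qed (use t in auto)
      then have "norm (L (f t) - L (f 0)) = norm (integral {0..t} (\<lambda>s. L (df 1 s)))"
        and "(\<lambda>s. L (df 1 s)) integrable_on {0..t}"
        by (auto simp: eq L.diff integral_unique integrable_on_def)
      note this(1)
      also have "norm (integral {0..t} (\<lambda>s. L (df 1 s))) \<le> integral {0..t} (\<lambda>s. norm (L (df 1 s)))"
      proof (rule integral_norm_bound_integral)
        show "(\<lambda>s. norm (L (df 1 s))) integrable_on {0..t}"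
          using cont' t by (intro integrable_continuous_real) (auto intro: continuous_on_subset)
      qed (use \<open>(\<lambda>s. L (df 1 s)) integrable_on {0..t}\<close> in auto)
      also have "\<dots> \<le> integral {0..T} (\<lambda>s. norm (L (df 1 s)))"
        using cont' t
        by (intro integral_subset_le integrable_continuous_real) (auto intro: continuous_on_subset)
      also have "\<dots> = (LINT s|lebesgue. norm (L (w s)))"
      proof -
        have norm_w: "(\<lambda>s. norm (L (w s))) = (\<lambda>s. indicator {0..T} s *\<^sub>R norm (L (df 1 s)))"
          by (auto simp: w_def L.scaleR L.zero split: split_indicator)
        then have "set_integrable lebesgue {0..T} (\<lambda>s. norm (L (df 1 s)))"
          using Lw by (simp add: set_integrable_def)
        from set_lebesgue_integral_eq_integral(2)[OF this] show ?thesis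
          unfolding norm_w by (simp add: set_lebesgue_integral_def)
      qed
      finally show ?thesis .
    qed
  qed
  then have "norm (L (f t)) \<le> norm (L (f 0)) + (LINT s|lebesgue. norm (L (w s)))"
    if "bounded_linear (L :: 'h \<Rightarrow> 'h)" and "t \<in> {0..T}" for L t
    using that norm_triangle_ineq2[of "L (f t)" "L (f 0)"] by fastforce
  then show thesis
    by (intro that[OF w]) auto
qed

section \<open>The contraction factor\<close>

text \<open>The limit at infinity controls large arguments. On the remaining compact interval there
  are no poles, so the modulus is continuous and attains a maximum below 1.\<close>

lemma stability_uniformly_lt_1:
  assumes stable: "stable_scheme S" and inf: "strictly_stable_at_infinity S" and "a > 0"
  obtains \<rho> where "\<rho> < 1" "\<And>x. x \<ge> a \<Longrightarrow> \<bar>rat_eval (stability S) x\<bar> \<le> \<rho>"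
proof -
  let ?R = "rat_eval (stability S)"
  obtain L where L: "(?R \<longlongrightarrow> L) at_top" "\<bar>L\<bar> < 1"
    using inf unfolding strictly_stable_at_infinity_def by blast
  have "eventually (\<lambda>x. \<bar>?R x\<bar> < (1 + \<bar>L\<bar>) / 2) at_top"
    using tendsto_rabs[OF L(1)] L(2) by (intro order_tendstoD) auto
  then obtain N where N: "\<And>x. x \<ge> N \<Longrightarrow> \<bar>?R x\<bar> < (1 + \<bar>L\<bar>) / 2"
    by (auto simp: eventually_at_top_linorder)
  have "poly (rat_den (stability S)) x \<noteq> 0" "\<bar>?R x\<bar> < 1" if "x \<ge> a" for x
    using stable that \<open>a > 0\<close> unfolding stable_scheme_def by auto
  note S = this
  \<comment> \<open>The endpoint \<open>max a N\<close> keeps the interval nonempty when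
    \<open>N < a\<close>.\<close>
  have "continuous_on {a..max a N} (\<lambda>x. \<bar>?R x\<bar>)"
    unfolding rat_eval_def using S by (intro continuous_intros) auto
  then obtain y where y: "y \<in> {a..max a N}" "\<And>x. x \<in> {a..max a N} \<Longrightarrow> \<bar>?R x\<bar> \<le> \<bar>?R y\<bar>"
    using continuous_attains_sup[of "{a..max a N}" "\<lambda>x. \<bar>?R x\<bar>"] by auto
  show thesis
  proof
    show "max ((1 + \<bar>L\<bar>) / 2) \<bar>?R y\<bar> < 1"
      using L(2) S(2) y(1) by auto
    show "\<bar>?R x\<bar> \<le> max ((1 + \<bar>L\<bar>) / 2) \<bar>?R y\<bar>" if "x \<ge> a" for x
      using N[of x] y(2)[of x] that by (cases "x \<ge> N") (auto simp: le_max_iff_disj less_imp_le)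
  qed
qed

text \<open>A real supremum dominates the elements of a set that is bounded above. Here, away from
  0, the numerator is at most 2 and the denominator at least \<open>1 - \<rho>\<close>.\<close>

lemma le_kappa_c:
  assumes F: "stable_scheme F" and G: "stable_scheme G" and inf: "strictly_stable_at_infinity G"
    and "J \<ge> 1" and "a > 0" and \<Lambda>: "\<And>s. s \<in> \<Lambda> \<Longrightarrow> s \<ge> a" and "s \<in> \<Lambda>"
  shows "\<bar>(rat_eval (stability F) (s / real J) ^ J - rat_eval (stability G) s)
      / (1 - \<bar>rat_eval (stability G) s\<bar>)\<bar> \<le> kappa_c (stability F) (stability G) J \<Lambda>"
proof -
  obtain \<rho> where \<rho>: "\<rho> < 1" "\<And>x. x \<ge> a \<Longrightarrow> \<bar>rat_eval (stability G) x\<bar> \<le> \<rho>"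
    using stability_uniformly_lt_1[OF G inf \<open>a > 0\<close>] by blast
  have "\<bar>(rat_eval (stability F) (x / real J) ^ J - rat_eval (stability G) x)
      / (1 - \<bar>rat_eval (stability G) x\<bar>)\<bar> \<le> 2 / (1 - \<rho>)" if "x \<in> \<Lambda>" for x
  proof -
    have x: "x \<ge> a"
      using \<Lambda> that by blast
    then have "x / real J > 0"
      using \<open>a > 0\<close> \<open>J \<ge> 1\<close> by simp
    then have "\<bar>rat_eval (stability F) (x / real J)\<bar> < 1"
      using F unfolding stable_scheme_def by blast
    then have "\<bar>rat_eval (stability F) (x / real J) ^ J\<bar> \<le> 1"
      by (simp add: power_abs power_le_one)
    then show ?thesis
      unfolding abs_divide using \<rho>(1) \<rho>(2)[OF x] by (intro frac_le) auto
  qed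
  then have "bdd_above ((\<lambda>x. \<bar>(rat_eval (stability F) (x / real J) ^ J - rat_eval (stability G) x)
      / (1 - \<bar>rat_eval (stability G) x\<bar>)\<bar>) ` \<Lambda>)"
    by (intro bdd_aboveI2)
  then show ?thesis
    unfolding kappa_c_def using \<open>s \<in> \<Lambda>\<close> by (intro cSUP_upper)
qed

section \<open>Summation over the modes\<close>

theorem theorem3p2:
  fixes A :: "'h::{real_inner, banach, second_countable_topology} \<Rightarrow> 'h" and D :: "'h set"
    and lam :: "nat \<Rightarrow> real" and T :: real and u0 :: 'h and f :: "real \<Rightarrow> 'h"
    and F G :: scheme and q_fine q_coarse :: nat
  assumes "densely_defined_linear D A"
    and "self_adjoint D A"
    and "positive_definite D A"
    and "compact_inverse D A"
    and "eigenvalue_sequence D A lam"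
    and "T > 0"
    and "q_fine \<ge> 1" and "admissible_scheme F q_fine"
    and "q_coarse \<ge> 1" and "admissible_scheme G q_coarse"
    and "source_regular D A T q_fine f" and "source_regular D A T q_coarse f"
  shows "\<exists>c. \<forall>(J::nat) (Nc::nat) (dT::real) (dt::real) (k::nat).
           J \<ge> 1 \<longrightarrow> dt > 0 \<longrightarrow> dT = real J * dt \<longrightarrow> real Nc = T / dT \<longrightarrow>
           (MAX n\<in>{1..Nc}. norm (parareal D A F G f u0 J dT dt k n
                                  - fine_solution D A F f u0 dt (n * J)))
             \<le> c * kappa_c (stability F) (stability G) J (range (\<lambda>j. dT * lam j)) ^ k"
proof -
  interpret discrete_spectrum D A lam
    using assms(1,2,5) by (rule discrete_spectrum.intro)
  have F: "stable_scheme F" "valid_nodes F" and G: "stable_scheme G" "valid_nodes G"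
    and G_inf: "strictly_stable_at_infinity G"
    using assms(8,10) unfolding admissible_scheme_def by auto
  obtain cF where cF: "0 \<le> cF"
    "\<And>x i. x > 0 \<Longrightarrow> i \<in> {1..stages F} \<Longrightarrow> \<bar>rat_eval (weight F i) x\<bar> \<le> cF"
    using weight_bound[OF F(1)] by blast
  obtain cG where cG: "0 \<le> cG"
    "\<And>x i. x > 0 \<Longrightarrow> i \<in> {1..stages G} \<Longrightarrow> \<bar>rat_eval (weight G i) x\<bar> \<le> cG"
    using weight_bound[OF G(1)] by blast
  obtain w :: "real \<Rightarrow> 'h" where w: "integrable lebesgue w"
    and f_le: "\<And>L t. bounded_linear (L :: 'h \<Rightarrow> 'h) \<Longrightarrow> t \<in> {0..T} \<Longrightarrow>
      norm (L (f t)) \<le> norm (L (f 0)) + (LINT s|lebesgue. norm (L (w s)))"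
    using source_projection_bound[OF assms(11,7,6)] by blast
  \<comment> \<open>\<open>b \<mu>\<close> bounds the source in its mode for all times.
    \<open>C\<close> collects the source growth of one fine and one coarse march over a total time
    of at most \<open>T\<close>, and the 2 in \<open>m\<close> counts the initial value once for
    each march.\<close>
  define b where "b \<mu> = norm (E \<mu> (f 0)) + (LINT s|lebesgue. norm (E \<mu> (w s)))" for \<mu>
  define C where "C = T * (real (stages F) * cF + real (stages G) * cG)"
  define m where "m \<mu> = 2 * norm (E \<mu> u0) + C * b \<mu>" for \<mu>
  \<comment> \<open>\<open>c\<close> is \<open>m\<close> with the projected norms replaced by full
    norms. It is fixed before \<open>J\<close>, \<open>dT\<close>, \<open>dt\<close> and
    \<open>k\<close> are introduced.\<close>
  define c where "c = 2 * norm u0 + C * (norm (f 0) + (LINT s|lebesgue. norm (w s)))"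
  have C: "0 \<le> C"
    using \<open>T > 0\<close> cF cG by (simp add: C_def)
  have b: "0 \<le> b \<mu>" for \<mu>
    by (simp add: b_def)
  then have m: "0 \<le> m \<mu>" for \<mu>
    using C by (simp add: m_def)
  have L2_m: "L2_set m K \<le> c" if "K \<subseteq> eigenvalues D A" for K
  proof -
    have "L2_set b K \<le> L2_set (\<lambda>\<mu>. norm (E \<mu> (f 0))) K + L2_set (\<lambda>\<mu>. LINT s|lebesgue. norm (E \<mu> (w s))) K"
      unfolding b_def by (rule L2_set_triangle_ineq)
    \<comment> \<open>Bessel's inequality for the value at time 0, Minkowski's integral inequality
      for the derivative.\<close>
    also have "\<dots> \<le> norm (f 0) + (LINT s|lebesgue. norm (w s))"
      by (intro add_mono L2_set_norm_P_le L2_set_integral_norm_P_le that w)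
    finally have "C * L2_set b K \<le> C * (norm (f 0) + (LINT s|lebesgue. norm (w s)))"
      using C by (intro mult_left_mono)
    moreover have "L2_set m K \<le> L2_set (\<lambda>\<mu>. 2 * norm (E \<mu> u0)) K + L2_set (\<lambda>\<mu>. C * b \<mu>) K"
      unfolding m_def by (rule L2_set_triangle_ineq)
    moreover have "\<dots> = 2 * L2_set (\<lambda>\<mu>. norm (E \<mu> u0)) K + C * L2_set b K"
      using C by (simp add: L2_set_right_distrib)
    ultimately show ?thesis
      using L2_set_norm_P_le[OF that, of u0] by (simp add: c_def)
  qed
  show ?thesis
  proof (intro exI[of _ c] allI impI)
    fix J Nc :: nat and dT dt :: real and k :: nat
    assume J: "J \<ge> 1" and dt: "dt > 0" and dT: "dT = real J * dt" and Nc: "real Nc = T / dT"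
    define \<kappa> where "\<kappa> = kappa_c (stability F) (stability G) J (range (\<lambda>j. dT * lam j))"
    define e where "e k n = parareal D A F G f u0 J dT dt k n - fine_solution D A F f u0 dt (n * J)" for k n
    have dT_pos: "dT > 0"
      using J dt dT by simp
    have NcT: "real Nc * dT = T"
      using Nc dT_pos by simp
    have lam0: "lam 0 > 0" and lam_ge: "\<And>j. lam 0 \<le> lam j"
      using lam unfolding eigenvalue_sequence_def by (auto simp: incseq_def)
    \<comment> \<open>This lower bound may shrink with the step size. It serves only to make the
      supremum in \<open>kappa_c\<close> an upper bound and does not enter \<open>c\<close>.\<close>
    have dT_lam0: "dT * lam 0 > 0" and \<Lambda>: "\<And>s. s \<in> range (\<lambda>j. dT * lam j) \<Longrightarrow> dT * lam 0 \<le> s"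
      using lam0 lam_ge dT_pos by auto
    have \<kappa>: "\<bar>(rat_eval (stability F) (dt * \<mu>) ^ J - rat_eval (stability G) (dT * \<mu>))
        / (1 - \<bar>rat_eval (stability G) (dT * \<mu>)\<bar>)\<bar> \<le> \<kappa>" if "\<mu> \<in> eigenvalues D A" for \<mu>
    proof -
      have "\<mu> \<in> range lam"
        using lam that unfolding eigenvalue_sequence_def by blast
      then have "dT * \<mu> \<in> range (\<lambda>j. dT * lam j)"
        by auto
      moreover have "dT * \<mu> / real J = dt * \<mu>"
        using J by (simp add: dT)
      ultimately show ?thesis
        using le_kappa_c[OF F(1) G(1) G_inf J dT_lam0 \<Lambda>, where s = "dT * \<mu>"]
        by (simp only: \<kappa>_def)
    qed
    \<comment> \<open>One eigenvalue suffices, as \<open>\<kappa>\<close> dominates an absolute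
      value.\<close>
    have "\<kappa> \<ge> 0"
    proof -
      have "lam 0 \<in> eigenvalues D A"
        using lam unfolding eigenvalue_sequence_def by blast
      from \<kappa>[OF this] show ?thesis
        by linarith
    qed
    \<comment> \<open>Iterate 0 is the coarse march, so the initial error is a difference of two
      marches, each bounded by stability separately.\<close>
    have init: "norm (E \<mu> (e 0 n)) \<le> m \<mu>" if n: "n \<le> Nc" and \<mu>: "\<mu> \<in> eigenvalues D A" for n \<mu>
    proof -
      have f_b: "norm (E \<mu> (f \<tau>)) \<le> b \<mu>" if "\<tau> \<in> {0..T}" for \<tau>
        unfolding b_def by (rule f_le[OF bounded_linear_P[OF \<mu>] that])
      have nT: "real n * dT \<le> T"
        using n dT_pos by (simp flip: NcT)
      then have nT': "real (n * J) * dt \<le> T"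
        by (simp add: dT mult.assoc)
      have "norm (E \<mu> (march D A G f 0 dT u0 n)) \<le> norm (E \<mu> u0) + real n * dT * (real (stages G) * cG * b \<mu>)"
        using nT by (intro norm_E_march_le[where T = T] G dT_pos \<mu> cG f_b) auto
      also have "\<dots> \<le> norm (E \<mu> u0) + T * (real (stages G) * cG * b \<mu>)"
        using nT cG b by (intro add_left_mono mult_right_mono) auto
      finally have G_le: "norm (E \<mu> (march D A G f 0 dT u0 n))
          \<le> norm (E \<mu> u0) + T * (real (stages G) * cG * b \<mu>)" .
      have "norm (E \<mu> (march D A F f 0 dt u0 (n * J)))
          \<le> norm (E \<mu> u0) + real (n * J) * dt * (real (stages F) * cF * b \<mu>)"
        using nT' by (intro norm_E_march_le[where T = T] F dt \<mu> cF f_b) auto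
      also have "\<dots> \<le> norm (E \<mu> u0) + T * (real (stages F) * cF * b \<mu>)"
        using nT' cF b by (intro add_left_mono mult_right_mono) auto
      finally have "norm (E \<mu> (march D A G f 0 dT u0 n)) + norm (E \<mu> (march D A F f 0 dt u0 (n * J)))
          \<le> m \<mu>"
        using G_le by (simp add: m_def C_def algebra_simps)
      moreover have "norm (E \<mu> (e 0 n))
          \<le> norm (E \<mu> (march D A G f 0 dT u0 n)) + norm (E \<mu> (march D A F f 0 dt u0 (n * J)))"
        unfolding e_def fine_solution_def parareal_0_eq_march linear_diff[OF linear_P[OF \<mu>]]
        by (rule norm_triangle_ineq4)
      ultimately show ?thesis
        by linarith
    qed
    \<comment> \<open>The factor \<open>\<kappa> ^ k\<close> is common to all modes and comes out of
      the \<open>L2_set\<close>, which leaves the sum of the initial bounds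
      \<open>m\<close>.\<close>
    have "norm (e k n) \<le> c * \<kappa> ^ k" if n: "n \<le> Nc" for n
    proof (rule norm_modal_le)
      show "modal (e k n)"
        unfolding e_def by (rule modal_parareal_error[OF F(1) G(1) dt dT_pos J])
      fix K assume K: "finite K" "K \<subseteq> eigenvalues D A"
      have "L2_set (\<lambda>\<mu>. norm (E \<mu> (e k n))) K \<le> L2_set (\<lambda>\<mu>. \<kappa> ^ k * m \<mu>) K"
      proof (rule L2_set_mono)
        fix \<mu> assume "\<mu> \<in> K"
        then have \<mu>: "\<mu> \<in> eigenvalues D A"
          using K by blast
        show "norm (E \<mu> (e k n)) \<le> \<kappa> ^ k * m \<mu>"
          unfolding e_def
          using init[OF _ \<mu>] by (intro norm_E_parareal_error_le[OF F(1) G(1) dt dT J \<mu> \<kappa>[OF \<mu>] _ n]) (simp add: e_def)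
      qed simp
      also have "\<dots> = \<kappa> ^ k * L2_set m K"
        using \<open>\<kappa> \<ge> 0\<close> by (simp add: L2_set_right_distrib)
      also have "\<dots> \<le> c * \<kappa> ^ k"
        using L2_m[OF K(2)] \<open>\<kappa> \<ge> 0\<close> by (simp add: mult.commute mult_right_mono)
      finally show "L2_set (\<lambda>\<mu>. norm (E \<mu> (e k n))) K \<le> c * \<kappa> ^ k" .
    qed
    \<comment> \<open>Makes the index set of the \<open>MAX\<close> nonempty, so that a bound for
      every \<open>n\<close> bounds the maximum.\<close>
    moreover have "Nc \<ge> 1"
      using NcT \<open>T > 0\<close> by (cases Nc) auto
    ultimately show "(MAX n\<in>{1..Nc}. norm (parareal D A F G f u0 J dT dt k n
          - fine_solution D A F f u0 dt (n * J)))
        \<le> c * kappa_c (stability F) (stability G) J (range (\<lambda>j. dT * lam j)) ^ k"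
      by (simp add: e_def \<kappa>_def)
  qed
qed

end
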